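(* For any integer $n\ge 1$, $H_n$ is a convex, polyhedral cone, given by $H_n=H_{m(n),n}$.
   Context: For a positive integer $k$ let $[k]=\{1,\dots,k\}$. $K_N$ is the undirected complete graph on vertex set $[N]$, with edge set $E_N=\{(i,j):1\le i<j\le N\}$. A weight map is a function $w:E_N\to\mathbb{R}_{\ge 0}$. For $W\subseteq[N]$, the cut $C(W)$ is the set of edges with exactly one endpoint in $W$, and $\|C(W)\|$ is the sum of the weights of its edges. For integers $1\le n<N$, the vertices in $[n]$ of $K_N$ are called terminals, vertex $N$ is the sink. Given $w$ on $K_N$, for each $\varnothing\ne I\subseteq[n]$ set $$S_I=\min\{\|C(W)\| : W\subseteq[N-1],\ W\cap[n]=I\}.$$ The resulting vector $S=(S_I)_{\varnothing\ne I\subseteq[n]}\in\mathbb{R}^{2^n-1}$ is said to be realized by $w$ in $K_N$. $H_n$ is the set of all $S\in\mathbb{R}^{2^n-1}$ realized by some weight map in $K_N$ for some $N>n$. For $N>n$, $H_{N,n}$ is the convex hull of the set of all $S\in\mathbb{R}^{2^n-1}$ realized by some weight map in $K_N$ (for this fixed $N$). The integer $m(n)$ is the smallest integer such that every $S\in H_n$ can be realized in $K_{m(n)}$ (such an integer exists). *)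

theory Defs
  imports "HOL-Analysis.Analysis"
begin

definition complete_edges :: "nat \<Rightarrow> (nat \<times> nat) set" where
  "complete_edges N = {(i, j). 1 \<le> i \<and> i < j \<and> j \<le> N}"

text \<open>Values of a weight map outside \<^term>\<open>complete_edges N\<close> are never used.\<close>

definition weight_map :: "nat \<Rightarrow> (nat \<times> nat \<Rightarrow> real) \<Rightarrow> bool" where
  "weight_map N w \<longleftrightarrow> (\<forall>e \<in> complete_edges N. 0 \<le> w e)"

definition cut_edges :: "nat \<Rightarrow> nat set \<Rightarrow> (nat \<times> nat) set" where
  "cut_edges N W = {(i, j) \<in> complete_edges N. (i \<in> W) \<noteq> (j \<in> W)}"

definition cut_weight :: "nat \<Rightarrow> (nat \<times> nat \<Rightarrow> real) \<Rightarrow> nat set \<Rightarrow> real" where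
  "cut_weight N w W = (\<Sum>e \<in> cut_edges N W. w e)"

definition min_cut :: "nat \<Rightarrow> nat \<Rightarrow> (nat \<times> nat \<Rightarrow> real) \<Rightarrow> nat set \<Rightarrow> real" where
  "min_cut n N w I = Min {cut_weight N w W | W. W \<subseteq> {1..N - 1} \<and> W \<inter> {1..n} = I}"

text \<open>
  The nonempty subsets of \<open>[n]\<close>. The space of vectors with these sets as coordinates is
  represented as \<open>real ^ 'k\<close>, together with a bijection \<open>ix\<close> from \<open>'k\<close> onto
  \<open>terminal_sets n\<close> that names the coordinates; in particular \<open>CARD('k) = 2 ^ n - 1\<close>, and for
  every \<open>n \<ge> 1\<close> there are finite types of that cardinality.
\<close>

definition terminal_sets :: "nat \<Rightarrow> nat set set" where
  "terminal_sets n = {I. I \<noteq> {} \<and> I \<subseteq> {1..n}}"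

definition realizes ::
    "('k::finite \<Rightarrow> nat set) \<Rightarrow> nat \<Rightarrow> nat \<Rightarrow> (nat \<times> nat \<Rightarrow> real) \<Rightarrow> real ^ 'k \<Rightarrow> bool" where
  "realizes ix n N w S \<longleftrightarrow> weight_map N w \<and> (\<forall>k. S $ k = min_cut n N w (ix k))"

definition realizable_in :: "('k::finite \<Rightarrow> nat set) \<Rightarrow> nat \<Rightarrow> nat \<Rightarrow> (real ^ 'k) set" where
  "realizable_in ix n N = {S. \<exists>w. realizes ix n N w S}"

definition realizable :: "('k::finite \<Rightarrow> nat set) \<Rightarrow> nat \<Rightarrow> (real ^ 'k) set" where
  "realizable ix n = {S. \<exists>N > n. S \<in> realizable_in ix n N}"

definition realizable_hull :: "('k::finite \<Rightarrow> nat set) \<Rightarrow> nat \<Rightarrow> nat \<Rightarrow> (real ^ 'k) set" where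
  "realizable_hull ix N n = convex hull (realizable_in ix n N)"

definition min_size :: "('k::finite \<Rightarrow> nat set) \<Rightarrow> nat \<Rightarrow> nat" where
  "min_size ix n = (LEAST m. n < m \<and> (\<forall>S \<in> realizable ix n. S \<in> realizable_in ix n m))"

end

theory Submission
  imports Defs
begin

text \<open>
  Fix a minimum cut \<open>W\<^sub>I\<close> for every \<open>I\<close> and merge all vertices lying in the same members of the
  family \<open>(W\<^sub>I)\<close>: no cut value of the merged network is new, and the chosen cuts survive. Hence
  the vertices may always be taken to be the \<open>2 ^ (2 ^ n - 1)\<close> membership patterns, with the
  chosen cut for \<open>I\<close> consisting of the patterns that contain \<open>I\<close>. Requiring these particular
  cuts to be minimum is a finite system of homogeneous linear inequalities in the weights, so
  \<open>H\<^sub>n\<close> is a linear image of a polyhedral cone in the nonnegative orthant. Such a cone is spanned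
  by the polytope of its points with coordinate sum 1, so its linear images are polyhedral.
\<close>

section \<open>Linear images of cones in the nonnegative orthant\<close>

lemma polyhedron_linear_image_nonneg_cone:
  fixes f :: "'a::euclidean_space \<Rightarrow> 'b::euclidean_space"
  assumes f: "linear f" and P: "polyhedron P" and cone: "convex_cone P"
    and nonneg: "\<And>x i. x \<in> P \<Longrightarrow> i \<in> Basis \<Longrightarrow> 0 \<le> x \<bullet> i"
  shows "polyhedron (f ` P)"
proof -
  define B where "B = P \<inter> {x. \<Sum>Basis \<bullet> x = 1}"
  have sum: "\<Sum>Basis \<bullet> x = (\<Sum>i\<in>Basis. x \<bullet> i)" for x :: 'a
    by (subst inner_commute) (rule inner_sum_right)
  have "B \<subseteq> cbox 0 (\<Sum>Basis)"
  proof
    fix x assume x: "x \<in> B"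
    have "x \<bullet> i \<le> 1" if "i \<in> Basis" for i
    proof -
      have "x \<bullet> i \<le> (\<Sum>i\<in>Basis. x \<bullet> i)"
        by (rule member_le_sum) (use that x nonneg in \<open>auto simp: B_def\<close>)
      then show ?thesis using x by (simp add: B_def sum)
    qed
    then show "x \<in> cbox 0 (\<Sum>Basis)"
      using x nonneg by (auto simp: mem_box B_def)
  qed
  then have "bounded B" by (rule bounded_subset[OF bounded_cbox])
  then have "polytope B"
    using P by (simp add: polytope_eq_bounded_polyhedron B_def polyhedron_hyperplane)
  then have poly: "polyhedron (conic hull (f ` B))"
    by (intro polyhedron_conic_hull_polytope polytope_linear_image f)
  have zero: "x = 0" if "x \<in> P" "\<Sum>Basis \<bullet> x = 0" for x
  proof (rule euclidean_eqI)
    have "(\<Sum>i\<in>Basis. x \<bullet> i) = 0" using that(2) unfolding sum .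
    then show "x \<bullet> i = 0 \<bullet> i" if "i \<in> Basis" for i
      using sum_nonneg_eq_0_iff[of Basis "\<lambda>i. x \<bullet> i"] nonneg[OF \<open>x \<in> P\<close>] that by simp
  qed
  have P0: "0 \<in> P" using cone by (rule convex_cone_contains_0)
  \<comment> \<open>The conic hull of the empty set is empty, so 0 is added for the case
    \<open>P = {0}\<close>; every nonzero point of \<open>P\<close> has positive coordinate sum and
    rescales into \<open>B\<close>.\<close>
  have eq: "P = insert 0 (conic hull B)"
  proof (intro equalityI subsetI)
    fix x assume x: "x \<in> P"
    show "x \<in> insert 0 (conic hull B)"
    proof (cases "x = 0")
      case False
      define s where "s = \<Sum>Basis \<bullet> x"
      have "s \<ge> 0" unfolding s_def sum using x nonneg by (intro sum_nonneg) auto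
      with False zero x have s: "s > 0" by (auto simp: s_def less_le)
      have "(1 / s) *\<^sub>R x \<in> B"
        using s x cone by (auto simp: B_def convex_cone_scaleR) (simp add: s_def)
      then have "s *\<^sub>R ((1 / s) *\<^sub>R x) \<in> conic hull B"
        using s unfolding conic_hull_explicit by fastforce
      then show ?thesis using s by simp
    qed auto
  next
    fix x assume "x \<in> insert 0 (conic hull B)"
    then show "x \<in> P"
      using P0 cone by (auto simp: conic_hull_explicit B_def convex_cone_scaleR)
  qed
  show ?thesis
  proof (cases "B = {}")
    case True
    then have "f ` P = {0}" using eq linear_0[OF f] by simp
    then show ?thesis by (simp add: polytope_imp_polyhedron polytope_sing)
  next
    case False
    then have "P = conic hull B" using eq by (simp add: insert_absorb)
    then have "f ` P = conic hull (f ` B)" using conic_hull_linear_image[OF f] by simp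
    then show ?thesis using poly by simp
  qed
qed

section \<open>Networks on the membership patterns\<close>

text \<open>
  A weight vector on a finite vertex type \<open>'v\<close> has a coordinate for every ordered pair; the two
  orientations of an edge, and loops, are harmless redundancy.
\<close>

definition cut_vector :: "'v::finite set \<Rightarrow> real ^ ('v \<times> 'v)" where
  "cut_vector W = (\<chi> e. if (fst e \<in> W) \<noteq> (snd e \<in> W) then 1 else 0)"

lemma cut_vector_inner:
  "cut_vector W \<bullet> x = (\<Sum>e \<in> {e. (fst e \<in> W) \<noteq> (snd e \<in> W)}. x $ e)"
  by (simp add: inner_vec_def cut_vector_def if_distrib[of "\<lambda>a. a * _"] sum.If_cases cong: if_cong)

section \<open>Cuts in \<open>K_N\<close> and their transport along vertex maps\<close>

definition admissible_cut :: "nat \<Rightarrow> nat \<Rightarrow> nat set \<Rightarrow> nat set \<Rightarrow> bool" where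
  "admissible_cut n N I W \<longleftrightarrow> W \<subseteq> {1..N - 1} \<and> W \<inter> {1..n} = I"

lemma admissible_cut_subset:
  assumes "admissible_cut n N I W"
  shows "W \<subseteq> {1..N}"
proof -
  have "{1..N - 1} \<subseteq> {1..N}" by auto
  with assms show ?thesis unfolding admissible_cut_def by blast
qed

lemma finite_complete_edges [simp]: "finite (complete_edges N)"
  by (rule finite_subset[of _ "{1..N} \<times> {1..N}"]) (auto simp: complete_edges_def)

lemma finite_cut_edges [simp]: "finite (cut_edges N W)"
  by (rule finite_subset[of _ "complete_edges N"]) (auto simp: cut_edges_def)

text \<open>As \<open>n < N\<close>, the set \<open>I\<close> is itself an admissible cut, so
  \<open>Min\<close> ranges over a finite nonempty set.\<close>

lemma min_cut_eq_iff:
  assumes "n < N" "I \<subseteq> {1..n}"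
  shows "s = min_cut n N w I \<longleftrightarrow>
    (\<exists>W. admissible_cut n N I W \<and> s = cut_weight N w W) \<and>
    (\<forall>W. admissible_cut n N I W \<longrightarrow> s \<le> cut_weight N w W)"
proof -
  let ?C = "{cut_weight N w W | W. W \<subseteq> {1..N - 1} \<and> W \<inter> {1..n} = I}"
  have "finite {W. W \<subseteq> {1..N - 1}}" by simp
  then have fin: "finite ?C"
    by (rule finite_surj[of _ _ "cut_weight N w"]) auto
  have "{1..n} \<subseteq> {1..N - 1}" using assms(1) by auto
  with assms(2) have "I \<subseteq> {1..N - 1}" "I \<inter> {1..n} = I" by blast+
  then have "?C \<noteq> {}" by blast
  then have "s = Min ?C \<longleftrightarrow> s \<in> ?C \<and> (\<forall>a \<in> ?C. s \<le> a)"
    unfolding eq_commute[of s "Min ?C"] by (rule Min_eq_iff[OF fin])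
  then show ?thesis
    unfolding min_cut_def admissible_cut_def by blast
qed

text \<open>The image of a network under a map of its vertices; parallel edges are added up.\<close>

lemma cut_vector_inner_pushforward:
  fixes N :: nat and p :: "nat \<Rightarrow> 'v::finite" and w :: "nat \<times> nat \<Rightarrow> real"
  defines "x \<equiv> (\<chi> d. \<Sum>e \<in> {e \<in> complete_edges N. map_prod p p e = d}. w e)"
  shows "cut_vector W \<bullet> x = cut_weight N w {i \<in> {1..N}. p i \<in> W}"
proof -
  let ?D = "{d. (fst d \<in> W) \<noteq> (snd d \<in> W)}" and ?V = "{i \<in> {1..N}. p i \<in> W}"
  \<comment> \<open>A fibre over a pair crossing \<open>W\<close> lies wholly in the cut of
    \<open>?V\<close>; edges collapsed to loops cross neither cut.\<close>
  have "{e \<in> complete_edges N. map_prod p p e = d} = {e \<in> cut_edges N ?V. map_prod p p e = d}"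
    if "d \<in> ?D" for d
    using that by (auto simp: cut_edges_def complete_edges_def)
  then have "cut_vector W \<bullet> x = (\<Sum>d\<in>?D. \<Sum>e \<in> {e \<in> cut_edges N ?V. map_prod p p e = d}. w e)"
    by (simp add: cut_vector_inner x_def)
  also have "\<dots> = (\<Sum>e \<in> cut_edges N ?V. w e)"
    by (rule sum.group[OF finite_cut_edges finite]) (auto simp: cut_edges_def complete_edges_def)
  finally show ?thesis by (simp add: cut_weight_def)
qed

text \<open>The ordered pairs crossing \<open>W\<close> are the disjoint union of the cut edges and
  their swaps, so an edge must carry the sum of both orientations.\<close>

lemma cut_weight_pullback:
  fixes q :: "nat \<Rightarrow> 'v::finite" and x :: "real ^ ('v \<times> 'v)"
  assumes q: "bij_betw q {1..M} UNIV" and W: "W \<subseteq> {1..M}"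
  shows "cut_weight M (\<lambda>(i, j). x $ (q i, q j) + x $ (q j, q i)) W = cut_vector (q ` W) \<bullet> x"
proof -
  let ?E = "cut_edges M W" and ?Q = "map_prod q q"
  have inj: "inj_on q {1..M}" and surj: "q ` {1..M} = UNIV"
    using q by (auto simp: bij_betw_def)
  have mem: "q i \<in> q ` W \<longleftrightarrow> i \<in> W" if "i \<in> {1..M}" for i
    using that W inj by (auto dest: inj_onD)
  let ?A = "{e \<in> {1..M} \<times> {1..M}. (fst e \<in> W) \<noteq> (snd e \<in> W)}"
  have A: "?A = ?E \<union> prod.swap ` ?E"
  proof (intro equalityI subsetI)
    fix e assume "e \<in> ?A"
    then obtain i j where e: "e = (i, j)" "i \<in> {1..M}" "j \<in> {1..M}" "(i \<in> W) \<noteq> (j \<in> W)" by auto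
    show "e \<in> ?E \<union> prod.swap ` ?E"
    proof (cases "i < j")
      case True
      with e show ?thesis by (auto simp: cut_edges_def complete_edges_def)
    next
      case False
      with e have "(j, i) \<in> ?E" by (auto simp: cut_edges_def complete_edges_def le_less not_less)
      then show ?thesis using e(1) by force
    qed
  qed (auto simp: cut_edges_def complete_edges_def)
  have bij: "bij_betw ?Q ?A {d. (fst d \<in> q ` W) \<noteq> (snd d \<in> q ` W)}"
  proof (rule bij_betw_imageI)
    show "inj_on ?Q ?A" by (rule inj_on_subset[OF map_prod_inj_on[OF inj inj]]) auto
    show "?Q ` ?A = {d. (fst d \<in> q ` W) \<noteq> (snd d \<in> q ` W)}"
    proof (intro equalityI subsetI)
      fix d assume "d \<in> ?Q ` ?A"
      then obtain e where "d = ?Q e" "e \<in> ?A" by (rule imageE)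
      then show "d \<in> {d. (fst d \<in> q ` W) \<noteq> (snd d \<in> q ` W)}"
        using mem by (simp add: mem_Times_iff)
    next
      fix d assume d: "d \<in> {d. (fst d \<in> q ` W) \<noteq> (snd d \<in> q ` W)}"
      obtain i j where ij: "i \<in> {1..M}" "j \<in> {1..M}" "d = (q i, q j)"
        using surj by (metis UNIV_I imageE surj_pair)
      with d mem have "(i, j) \<in> ?A" by auto
      with ij show "d \<in> ?Q ` ?A" by force
    qed
  qed
  have "cut_vector (q ` W) \<bullet> x = (\<Sum>e\<in>?A. x $ ?Q e)"
    unfolding cut_vector_inner by (rule sum.reindex_bij_betw[OF bij, symmetric])
  also have "\<dots> = (\<Sum>e\<in>?E. x $ ?Q e) + (\<Sum>e \<in> prod.swap ` ?E. x $ ?Q e)"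
    unfolding A by (rule sum.union_disjoint[OF finite_cut_edges finite_imageI[OF finite_cut_edges]])
      (auto simp: cut_edges_def complete_edges_def)
  also have "(\<Sum>e \<in> prod.swap ` ?E. x $ ?Q e) = (\<Sum>e\<in>?E. x $ ?Q (prod.swap e))"
    by (simp add: sum.reindex)
  finally show ?thesis
    by (simp add: cut_weight_def sum.distrib split_def map_prod_def)
qed

section \<open>The cone of pattern weights\<close>

text \<open>
  Terminal \<open>i\<close> is the pattern \<open>{k. i \<in> ix k}\<close> and the sink is the empty pattern; the cut designated
  as minimum for \<open>ix k\<close> is \<open>{v. k \<in> v}\<close>.
\<close>

definition pattern_admissible :: "('k::finite \<Rightarrow> nat set) \<Rightarrow> nat \<Rightarrow> 'k \<Rightarrow> 'k set set \<Rightarrow> bool" where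
  "pattern_admissible ix n k W \<longleftrightarrow>
    {} \<notin> W \<and> (\<forall>i \<in> {1..n}. {l. i \<in> ix l} \<in> W \<longleftrightarrow> i \<in> ix k)"

definition pattern_cone :: "('k::finite \<Rightarrow> nat set) \<Rightarrow> nat \<Rightarrow> (real ^ ('k set \<times> 'k set)) set" where
  "pattern_cone ix n = {x. (\<forall>e. 0 \<le> x $ e) \<and>
    (\<forall>k W. pattern_admissible ix n k W \<longrightarrow> cut_vector {v. k \<in> v} \<bullet> x \<le> cut_vector W \<bullet> x)}"

text \<open>On \<open>pattern_cone\<close> these are the minimum cut values: designating the
  minimizers in advance replaces a piecewise linear map by a linear one.\<close>

definition pattern_cuts :: "real ^ ('k::finite set \<times> 'k set) \<Rightarrow> real ^ 'k" where
  "pattern_cuts x = (\<chi> k. cut_vector {v. k \<in> v} \<bullet> x)"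

lemma linear_pattern_cuts: "linear pattern_cuts"
  by (rule linearI) (simp_all add: pattern_cuts_def vec_eq_iff inner_add_right)

lemma pattern_cone_Inter:
  "pattern_cone ix n =
    \<Inter> (range (\<lambda>e. {x. axis e 1 \<bullet> x \<ge> 0}) \<union>
       (\<lambda>(k, W). {x. (cut_vector W - cut_vector {v. k \<in> v}) \<bullet> x \<ge> 0}) `
         {(k, W). pattern_admissible ix n k W})"
  by (auto simp: pattern_cone_def inner_axis' inner_diff_left)

lemma convex_cone_pattern_cone: "convex_cone (pattern_cone ix n)"
  unfolding pattern_cone_Inter
  by (rule convex_cone_Inter) (auto intro: convex_cone_halfspace_ge)

lemma polyhedron_pattern_cone: "polyhedron (pattern_cone ix n)"
  unfolding pattern_cone_Inter
  by (rule polyhedron_Inter) (auto intro: polyhedron_halfspace_ge)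

lemma polyhedron_pattern_cuts: "polyhedron (pattern_cuts ` pattern_cone ix n)"
  by (rule polyhedron_linear_image_nonneg_cone
      [OF linear_pattern_cuts polyhedron_pattern_cone convex_cone_pattern_cone])
    (auto simp: pattern_cone_def Basis_vec_def inner_axis)

text \<open>After merging, the preimage of \<open>{v. k \<in> v}\<close> is the chosen minimum cut
  \<open>V k\<close>, and the preimage of any pattern-admissible family is a competing cut for
  \<open>ix k\<close>.\<close>

lemma realizable_in_subset_pattern_cuts:
  assumes ix: "bij_betw ix UNIV (terminal_sets n)" and N: "n < N"
  shows "realizable_in ix n N \<subseteq> pattern_cuts ` pattern_cone ix n"
proof
  fix S assume "S \<in> realizable_in ix n N"
  then obtain w where w: "weight_map N w" and S: "\<And>k. S $ k = min_cut n N w (ix k)"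
    by (auto simp: realizable_in_def realizes_def)
  have sub: "ix k \<subseteq> {1..n}" for k
    using ix by (auto simp: bij_betw_def terminal_sets_def)
  note S' = S[unfolded min_cut_eq_iff[OF N sub]]
  from S' obtain V where V: "\<And>k. admissible_cut n N (ix k) (V k)"
      and SV: "\<And>k. S $ k = cut_weight N w (V k)"
    by metis
  from S' have S_le: "S $ k \<le> cut_weight N w W" if "admissible_cut n N (ix k) W" for k W
    using that by blast
  define p where "p i = {k. i \<in> V k}" for i
  define x where "x = (\<chi> d. \<Sum>e \<in> {e \<in> complete_edges N. map_prod p p e = d}. w e)"
  have cut: "cut_vector W \<bullet> x = cut_weight N w {i \<in> {1..N}. p i \<in> W}" for W
    unfolding x_def by (rule cut_vector_inner_pushforward)
  have pN: "p N = {}"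
    using V N by (fastforce simp: p_def admissible_cut_def)
  have pt: "p i = {l. i \<in> ix l}" if "i \<in> {1..n}" for i
    using V that by (fastforce simp: p_def admissible_cut_def)
  have VN: "V k \<subseteq> {1..N}" for k
    using V by (rule admissible_cut_subset)
  have "{i \<in> {1..N}. p i \<in> {v. k \<in> v}} = V k" for k
    using VN[of k] by (auto simp: p_def)
  then have cutV: "cut_vector {v. k \<in> v} \<bullet> x = S $ k" for k
    by (simp add: cut SV)
  have "cut_vector {v. k \<in> v} \<bullet> x \<le> cut_vector W \<bullet> x" if W: "pattern_admissible ix n k W" for k W
  proof -
    \<comment> \<open>The sink has pattern \<open>{}\<close>, which is never in
      \<open>W\<close>.\<close>
    have "i \<le> N - 1" if "i \<le> N" "p i \<in> W" for i
      using that pN W by (cases "i = N") (auto simp: pattern_admissible_def)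
    moreover have "{i \<in> {1..N}. p i \<in> W} \<inter> {1..n} = ix k"
    proof -
      have "{i \<in> {1..N}. p i \<in> W} \<inter> {1..n} = {i \<in> {1..n}. p i \<in> W}" using N by auto
      also have "\<dots> = {i \<in> {1..n}. i \<in> ix k}"
        using W pt by (intro Collect_cong conj_cong refl) (simp add: pattern_admissible_def)
      finally show ?thesis using sub[of k] by blast
    qed
    ultimately have "admissible_cut n N (ix k) {i \<in> {1..N}. p i \<in> W}"
      by (auto simp: admissible_cut_def)
    then show ?thesis unfolding cutV unfolding cut by (rule S_le)
  qed
  moreover have "0 \<le> x $ e" for e
    using w by (auto simp: x_def weight_map_def intro: sum_nonneg)
  ultimately have "x \<in> pattern_cone ix n" by (simp add: pattern_cone_def)
  moreover have "S = pattern_cuts x" by (simp add: pattern_cuts_def vec_eq_iff cutV)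
  ultimately show "S \<in> pattern_cuts ` pattern_cone ix n" by blast
qed

text \<open>Each singleton \<open>{i}\<close> is some \<open>ix k\<close>, so the terminal patterns
  are distinct and nonempty. With the sink this pins \<open>n + 1\<close> vertices; the remaining
  patterns are numbered arbitrarily.\<close>

lemma exists_pattern_enumeration:
  fixes ix :: "'k::finite \<Rightarrow> nat set"
  assumes ix: "bij_betw ix UNIV (terminal_sets n)"
  shows "n < CARD('k set) \<and> (\<exists>q. bij_betw q {1..CARD('k set)} (UNIV :: 'k set set) \<and>
    (\<forall>i \<in> {1..n}. q i = {k. i \<in> ix k}) \<and> q (CARD('k set)) = {})"
proof -
  define t where "t i = {k. i \<in> ix k}" for i
  define M where "M = CARD('k set)"
  have ex: "\<exists>k. ix k = {i}" if "i \<in> {1..n}" for i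
  proof -
    have "{i} \<in> terminal_sets n" using that by (auto simp: terminal_sets_def)
    then show ?thesis using ix by (metis bij_betw_imp_surj_on imageE)
  qed
  have inj: "inj_on t {1..n}"
  proof (rule inj_onI)
    fix i j assume i: "i \<in> {1..n}" and "t i = t j"
    from ex[OF i] obtain k where "ix k = {i}" ..
    with \<open>t i = t j\<close> show "i = j" by (auto simp: t_def set_eq_iff)
  qed
  have ne: "{} \<notin> t ` {1..n}" using ex by (force simp: t_def)
  let ?T = "insert {} (t ` {1..n})"
  have card: "card ?T = Suc n" using ne inj by (simp add: card_image)
  have "card ?T \<le> M" unfolding M_def by (rule card_mono) auto
  with card have nM: "n < M" by simp
  have "card {Suc n..<M} = card (UNIV - ?T)"
    using card nM by (subst card_Diff_subset) (auto simp: M_def)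
  then obtain g where g: "bij_betw g {Suc n..<M} (UNIV - ?T)"
    using finite_same_card_bij[of "{Suc n..<M}" "UNIV - ?T"] by auto
  define q where "q i = (if i \<in> {1..n} then t i else if i = M then {} else g i)" for i
  have "bij_betw q {1..n} (t ` {1..n})"
    using inj_on_imp_bij_betw[OF inj]
    by (rule bij_betw_cong[THEN iffD1, rotated]) (simp add: q_def)
  moreover have "bij_betw q {M} {{}}" using nM by (auto simp: q_def)
  moreover have "bij_betw q {Suc n..<M} (UNIV - ?T)"
    using g by (rule bij_betw_cong[THEN iffD1, rotated]) (auto simp: q_def)
  ultimately have "bij_betw q ({1..n} \<union> {M} \<union> {Suc n..<M}) (t ` {1..n} \<union> {{}} \<union> (UNIV - ?T))"
    using ne by (intro bij_betw_combine) auto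
  moreover have "{1..n} \<union> {M} \<union> {Suc n..<M} = {1..M}" using nM by auto
  moreover have "t ` {1..n} \<union> {{}} \<union> (UNIV - ?T) = UNIV" by auto
  ultimately have "bij_betw q {1..M} UNIV" by simp
  moreover have "\<forall>i \<in> {1..n}. q i = {k. i \<in> ix k}" "q M = {}"
    using nM by (auto simp: q_def t_def)
  ultimately show ?thesis using nM unfolding M_def by blast
qed

text \<open>Numbering the patterns by \<open>q\<close> turns admissible cuts into pattern-admissible
  families, so the cone inequalities make each designated cut minimum.\<close>

lemma pattern_cuts_subset_realizable_in:
  fixes ix :: "'k::finite \<Rightarrow> nat set"
  assumes ix: "bij_betw ix UNIV (terminal_sets n)"
  shows "pattern_cuts ` pattern_cone ix n \<subseteq> realizable_in ix n (CARD('k set))"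
proof
  fix S assume "S \<in> pattern_cuts ` pattern_cone ix n"
  then obtain x where x: "x \<in> pattern_cone ix n" and S: "S = pattern_cuts x" by blast
  define M where "M = CARD('k set)"
  from exists_pattern_enumeration[OF ix] obtain q where nM: "n < M"
      and q: "bij_betw q {1..M} (UNIV :: 'k set set)"
      and qt: "\<And>i. i \<in> {1..n} \<Longrightarrow> q i = {k. i \<in> ix k}" and qM: "q M = {}"
    unfolding M_def by blast
  have sub: "ix k \<subseteq> {1..n}" for k
    using ix by (auto simp: bij_betw_def terminal_sets_def)
  define w where "w = (\<lambda>(i, j). x $ (q i, q j) + x $ (q j, q i))"
  have cut: "cut_weight M w W = cut_vector (q ` W) \<bullet> x" if "W \<subseteq> {1..M}" for W
    unfolding w_def by (rule cut_weight_pullback[OF q that])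
  have mem: "q i \<in> q ` W \<longleftrightarrow> i \<in> W" if "i \<in> {1..M}" "W \<subseteq> {1..M}" for i W
    using that q by (auto simp: bij_betw_def dest: inj_onD)
  have "S $ k = min_cut n M w (ix k)" for k
    unfolding min_cut_eq_iff[OF nM sub]
  proof (intro conjI allI impI)
    \<comment> \<open>The designated cut, transported back through \<open>q\<close>.\<close>
    let ?W = "{i \<in> {1..M}. k \<in> q i}"
    have "i \<le> M - 1" if "i \<in> ?W" for i
      using that qM by (cases "i = M") auto
    moreover have "?W \<inter> {1..n} = ix k"
    proof -
      have "?W \<inter> {1..n} = {i \<in> {1..n}. k \<in> q i}" using nM by auto
      also have "\<dots> = {i \<in> {1..n}. i \<in> ix k}"
        using qt by (intro Collect_cong conj_cong refl) simp
      finally show ?thesis using sub[of k] by blast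
    qed
    ultimately have "admissible_cut n M (ix k) ?W" by (auto simp: admissible_cut_def)
    moreover have "q ` ?W = {v \<in> q ` {1..M}. k \<in> v}" by blast
    then have W: "q ` ?W = {v. k \<in> v}" unfolding bij_betw_imp_surj_on[OF q] by simp
    have WM: "?W \<subseteq> {1..M}" by auto
    have "S $ k = cut_weight M w ?W"
      unfolding cut[OF WM] W by (simp add: S pattern_cuts_def)
    ultimately show "\<exists>W. admissible_cut n M (ix k) W \<and> S $ k = cut_weight M w W" by blast
  next
    fix W assume W: "admissible_cut n M (ix k) W"
    then have WM: "W \<subseteq> {1..M}" by (rule admissible_cut_subset)
    have "M \<notin> W" using W nM by (auto simp: admissible_cut_def)
    then have "{} \<notin> q ` W" using mem[OF _ WM, of M] qM nM by simp
    moreover have "{l. i \<in> ix l} \<in> q ` W \<longleftrightarrow> i \<in> ix k" if "i \<in> {1..n}" for i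
      using mem[OF _ WM, of i] qt[OF that] that nM W by (auto simp: admissible_cut_def)
    ultimately have "pattern_admissible ix n k (q ` W)" by (simp add: pattern_admissible_def)
    then show "S $ k \<le> cut_weight M w W"
      using x by (simp add: cut[OF WM] S pattern_cuts_def pattern_cone_def)
  qed
  moreover have "weight_map M w"
    using x by (auto simp: weight_map_def w_def pattern_cone_def)
  ultimately have "realizes ix n M w S" by (simp add: realizes_def)
  then show "S \<in> realizable_in ix n (CARD('k set))"
    unfolding realizable_in_def M_def by blast
qed

theorem corollary2:
  fixes n :: nat and ix :: "'k::finite \<Rightarrow> nat set"
  assumes "1 \<le> n" and "bij_betw ix UNIV (terminal_sets n)"
  shows "convex_cone (realizable ix n) \<and> polyhedron (realizable ix n) \<and>
    realizable ix n = realizable_hull ix (min_size ix n) n"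
proof -
  note ix = assms(2)
  have nM: "n < CARD('k set)" using exists_pattern_enumeration[OF ix] by blast
  have eq: "realizable ix n = pattern_cuts ` pattern_cone ix n"
    using realizable_in_subset_pattern_cuts[OF ix] pattern_cuts_subset_realizable_in[OF ix] nM
    unfolding realizable_def by blast
  have cone: "convex_cone (realizable ix n)"
    unfolding eq by (rule convex_cone_linear_image[OF conjI[OF convex_cone_pattern_cone linear_pattern_cuts]])
  \<comment> \<open>The single size \<open>CARD('k set)\<close> realizes everything, so the
    \<open>LEAST\<close> in \<open>min_size\<close> is attained.\<close>
  have "n < min_size ix n \<and> (\<forall>S \<in> realizable ix n. S \<in> realizable_in ix n (min_size ix n))"
    unfolding min_size_def
    by (rule LeastI[of _ "CARD('k set)"])
      (use nM pattern_cuts_subset_realizable_in[OF ix] eq in auto)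
  then have "realizable_in ix n (min_size ix n) = realizable ix n"
    by (auto simp: realizable_def)
  then have "realizable_hull ix (min_size ix n) n = convex hull (realizable ix n)"
    by (simp add: realizable_hull_def)
  \<comment> \<open>The realizable set is already convex, so taking the hull adds nothing.\<close>
  also have "\<dots> = realizable ix n"
    using cone by (simp add: convex_cone_def convex_hull_eq)
  finally show ?thesis
    using cone polyhedron_pattern_cuts[of ix n] eq by simp
qed

end
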